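(* Let $\Sigma$ be a finite set, let $p\in\Delta(\Sigma)$ have full support, let $G=(G_u)_{u\in\Sigma}$ be a random vector with support $\mathbb{G}\subseteq\mathbb{R}^{|\Sigma|}$ and i.i.d. coordinates from a continuous law $\mathcal{L}$, and let $\varepsilon\ge0$. Consider the optimization problem $$q^*\in\arg\max_{q:\mathbb{G}\to\Delta(\Sigma)}\ \mathbb{E}\big[G\cdot q(G)\big]\quad\text{subject to}\quad\big(p-\mathbb{E}[q(G)]\big)\cdot\log p\le\varepsilon .$$ Then an optimal solution is given by $$\forall g\in\mathbb{G},\qquad q^*(g)=\arg\max_{i\in\Sigma}\big(g_i+\lambda\log p_i\big),$$ where an element of $\Sigma$ is identified with the point mass at it, and where $\lambda$ is chosen such that $\big(p-\mathbb{E}[q^*(G)]\big)\cdot\log p=\varepsilon$ if feasible, else $\lambda=0$.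
   Context: $\Delta(\Sigma)$ is the set of probability vectors on the finite set $\Sigma$; full support means $p_u>0$ for all $u\in\Sigma$. $\log p=(\log p_u)_{u\in\Sigma}$, and the dot product is $x\cdot y=\sum_{u\in\Sigma}x_uy_u$. The expectation $\mathbb{E}[q(G)]\in\Delta(\Sigma)$ is taken coordinatewise over $G$. The parameter $\lambda$ is a real number.
   Formalization: λ is sought among nonnegative reals: over all real λ the claim fails (p=(.9,.1), Gaussian G, ε=1.5 gives equality only at some λ<0, which is suboptimal). The law is also assumed to have finite mean, so that E[G·q(G)] is defined. *)

theory Defs
  imports "HOL-Probability.Probability"
begin

definition prob_vectors :: "(real ^ 'a::finite) set" where
  "prob_vectors = {x. (\<forall>u. 0 \<le> x $ u) \<and> (\<Sum>u\<in>UNIV. x $ u) = 1}"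

definition log_vec :: "real ^ 'a \<Rightarrow> real ^ 'a::finite" where
  "log_vec p = (\<chi> u. ln (p $ u))"

text \<open>Topological support of the law of \<open>G\<close>: the points all of whose open neighbourhoods are
  charged.\<close>

definition rv_support :: "'w measure \<Rightarrow> ('w \<Rightarrow> 'b::topological_space) \<Rightarrow> 'b set" where
  "rv_support M G = {g. \<forall>U. open U \<longrightarrow> g \<in> U \<longrightarrow> 0 < measure M (G -` U \<inter> space M)}"

text \<open>The competitors \<open>q\<close> map the support of \<open>G\<close> to probability vectors, and are measurable so that
  \<open>q(G)\<close> is a random vector. HOL functions being total, \<open>q\<close> also has (unconstrained) values off the
  support; these are irrelevant because \<open>G\<close> lies in its support almost surely, and since the support
  is closed every measurable function on it has a measurable extension.\<close>

definition policies :: "'w measure \<Rightarrow> ('w \<Rightarrow> real ^ 'a) \<Rightarrow> (real ^ 'a \<Rightarrow> real ^ 'a::finite) set" where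
  "policies M G = {q \<in> borel_measurable borel. \<forall>g\<in>rv_support M G. q g \<in> prob_vectors}"

definition mean_policy ::
    "'w measure \<Rightarrow> ('w \<Rightarrow> real ^ 'a) \<Rightarrow> (real ^ 'a \<Rightarrow> real ^ 'a) \<Rightarrow> real ^ 'a::finite" where
  "mean_policy M G q = (\<chi> u. \<integral>\<omega>. q (G \<omega>) $ u \<partial>M)"

definition objective ::
    "'w measure \<Rightarrow> ('w \<Rightarrow> real ^ 'a) \<Rightarrow> (real ^ 'a \<Rightarrow> real ^ 'a::finite) \<Rightarrow> real" where
  "objective M G q = (\<integral>\<omega>. G \<omega> \<bullet> q (G \<omega>) \<partial>M)"

definition log_gap ::
    "'w measure \<Rightarrow> ('w \<Rightarrow> real ^ 'a) \<Rightarrow> real ^ 'a \<Rightarrow> (real ^ 'a \<Rightarrow> real ^ 'a::finite) \<Rightarrow> real" where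
  "log_gap M G p q = (p - mean_policy M G q) \<bullet> log_vec p"

definition optimal_policy ::
    "'w measure \<Rightarrow> ('w \<Rightarrow> real ^ 'a) \<Rightarrow> real ^ 'a \<Rightarrow> real \<Rightarrow> (real ^ 'a \<Rightarrow> real ^ 'a::finite) \<Rightarrow> bool" where
  "optimal_policy M G p \<epsilon> q \<longleftrightarrow>
     is_arg_max (objective M G) (\<lambda>r. r \<in> policies M G \<and> log_gap M G p r \<le> \<epsilon>) q"

text \<open>The rule \<open>q(g) = argmax\<^sub>i (g\<^sub>i + \<lambda> log p\<^sub>i)\<close>; \<open>axis i 1\<close> is the point mass at \<open>i\<close>. A maximizer need
  not be unique, so this is a predicate on \<open>q\<close>: ties may be broken in any measurable way.\<close>

definition argmax_policy ::
    "'w measure \<Rightarrow> ('w \<Rightarrow> real ^ 'a) \<Rightarrow> real ^ 'a \<Rightarrow> real \<Rightarrow> (real ^ 'a \<Rightarrow> real ^ 'a::finite) \<Rightarrow> bool" where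
  "argmax_policy M G p lam q \<longleftrightarrow> q \<in> policies M G \<and>
     (\<forall>g\<in>rv_support M G. \<exists>i. is_arg_max (\<lambda>j. g $ j + lam * ln (p $ j)) (\<lambda>_. True) i \<and> q g = axis i 1)"

text \<open>The choice of \<open>\<lambda>\<close>: equality in the constraint if feasible, else \<open>\<lambda> = 0\<close>. As the multiplier of
  an inequality constraint, \<open>\<lambda>\<close> is sought among the nonnegative reals: when the constraint is slack at
  \<open>\<lambda> = 0\<close>, equality may also be attained at some \<open>\<lambda> < 0\<close>, where the rule is suboptimal.\<close>

definition multiplier_choice ::
    "'w measure \<Rightarrow> ('w \<Rightarrow> real ^ 'a) \<Rightarrow> real ^ 'a \<Rightarrow> real \<Rightarrow> real \<Rightarrow> (real ^ 'a \<Rightarrow> real ^ 'a::finite) \<Rightarrow> bool" where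
  "multiplier_choice M G p \<epsilon> lam q \<longleftrightarrow>
     (if \<exists>mu\<ge>0. \<exists>r. argmax_policy M G p mu r \<and> log_gap M G p r = \<epsilon>
      then 0 \<le> lam \<and> log_gap M G p q = \<epsilon> else lam = 0)"

end

theory Submission
  imports Defs
begin

text \<open>For \<open>\<lambda> \<ge> 0\<close> the rule maximizes the Lagrangian integrand \<open>g \<bullet> q + \<lambda> (log p \<bullet> q)\<close> pointwise, so
  equality in the constraint makes it optimal. It remains to see that if no multiplier attains
  equality, then the rule with \<open>\<lambda> = 0\<close> is feasible. Ties have probability zero, so the gap of the rule
  is a continuous function of \<open>\<lambda>\<close>; for \<open>\<lambda> \<rightarrow> \<infinity>\<close> it tends to \<open>p \<bullet> log p - max log p \<le> 0\<close>. Hence a gap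
  above \<open>\<epsilon>\<close> at \<open>\<lambda> = 0\<close> would, by the intermediate value theorem, be brought to \<open>\<epsilon>\<close> by some \<open>\<lambda> \<ge> 0\<close>,
  unless \<open>p\<close> is uniform, in which case all gaps vanish.\<close>

section \<open>Support of a random variable and null events from independence\<close>

lemma borel_measurable_vec_iff:
  fixes f :: "'w \<Rightarrow> real ^ 'a::finite"
  shows "f \<in> borel_measurable M \<longleftrightarrow> (\<forall>i. (\<lambda>x. f x $ i) \<in> borel_measurable M)"
  by (subst borel_measurable_euclidean_space) (auto simp: Basis_vec_def inner_axis)

text \<open>The complement of the support is a union of open sets of measure zero. By the Lindelof
  property countably many of them already cover it, so it is null.\<close>

lemma AE_in_rv_support:
  fixes G :: "'w \<Rightarrow> 'b::second_countable_topology"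
  assumes "finite_measure M" and G[measurable]: "G \<in> borel_measurable M"
  shows "AE \<omega> in M. G \<omega> \<in> rv_support M G"
proof -
  interpret finite_measure M by fact
  define F where "F = {U. open U \<and> measure M (G -` U \<inter> space M) = 0}"
  have opF: "\<And>U. U \<in> F \<Longrightarrow> open U" by (simp add: F_def)
  obtain F' where F': "F' \<subseteq> F" "countable F'" "\<Union>F' = \<Union>F"
    using Lindelof[of F] opF by metis
  have "(\<Union>U\<in>F'. G -` U \<inter> space M) \<in> null_sets M"
  proof (rule null_sets_UN'[OF F'(2)])
    fix U assume "U \<in> F'"
    then have U: "open U" "measure M (G -` U \<inter> space M) = 0" using F' by (auto simp: F_def)
    then show "G -` U \<inter> space M \<in> null_sets M"
      by (intro null_setsI) (auto simp: emeasure_eq_measure intro!: measurable_sets[OF G])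
  qed
  from AE_not_in[OF this] AE_space show ?thesis
  proof eventually_elim
    case (elim \<omega>)
    then have "G \<omega> \<notin> \<Union>F" using F'(3) by auto
    then show ?case
      by (fastforce simp: F_def rv_support_def zero_less_measure_iff)
  qed
qed

text \<open>By independence the joint law is a product. For a fixed value of \<open>X\<close> the
  forbidden set of values of \<open>Y\<close> is a single point, which is null, and integrating over
  \<open>X\<close> gives the claim.\<close>

lemma (in prob_space) AE_indep_neq_shift:
  fixes X Y :: "'a \<Rightarrow> real"
  assumes ind: "indep_var borel X borel Y"
    and atomless: "\<And>y. measure (distr M borel Y) {y} = 0"
  shows "AE \<omega> in M. Y \<omega> \<noteq> X \<omega> + c"
proof -
  have [measurable]: "random_variable borel X" "random_variable borel Y"
    using ind by (auto dest: indep_var_rv1 indep_var_rv2)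
  have eq: "distr M borel X \<Otimes>\<^sub>M distr M borel Y = distr M (borel \<Otimes>\<^sub>M borel) (\<lambda>x. (X x, Y x))"
    using ind by (simp add: indep_var_distribution_eq)
  interpret X: prob_space "distr M borel X" by (rule prob_space_distr) simp
  interpret Y: prob_space "distr M borel Y" by (rule prob_space_distr) simp
  interpret pair_prob_space "distr M borel X" "distr M borel Y" ..
  have pt: "AE y in distr M borel Y. y \<noteq> a" for a
    by (rule AE_I[of _ _ "{a}"]) (auto simp: Y.emeasure_eq_measure atomless)
  have [measurable]: "{z :: real \<times> real. snd z \<noteq> fst z + c} \<in> sets (borel \<Otimes>\<^sub>M borel)"
  proof -
    have "{z \<in> space (borel \<Otimes>\<^sub>M borel :: (real \<times> real) measure). snd z \<noteq> fst z + c}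
      \<in> sets (borel \<Otimes>\<^sub>M borel)"
      by measurable
    then show ?thesis by (simp add: space_pair_measure)
  qed
  have "AE z in distr M borel X \<Otimes>\<^sub>M distr M borel Y. snd z \<noteq> fst z + c"
    by (rule AE_pair_measure) (auto intro!: pt simp: space_pair_measure)
  then show ?thesis
    unfolding eq by (subst (asm) AE_distr_iff) auto
qed

lemma (in prob_space) indep_vars_imp_indep_var:
  assumes "indep_vars N X I" "i \<in> I" "j \<in> I" "i \<noteq> j"
  shows "indep_var (N i) (X i) (N j) (X j)"
proof -
  have "indep_var (PiM {i} N) (\<lambda>\<omega>. restrict (\<lambda>k. X k \<omega>) {i}) (PiM {j} N) (\<lambda>\<omega>. restrict (\<lambda>k. X k \<omega>) {j})"
    using assms by (intro indep_var_restrict[OF assms(1)]) auto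
  from indep_var_compose[OF this measurable_component_singleton[of i] measurable_component_singleton[of j]]
  show ?thesis by (simp add: comp_def)
qed

section \<open>A measurable argmax selection\<close>

definition score :: "real \<Rightarrow> real ^ 'a \<Rightarrow> real ^ 'a \<Rightarrow> 'a::finite \<Rightarrow> real" where
  "score lam c g j = g $ j + lam * c $ j"

text \<open>Ties go to the least \<open>to_nat\<close> index. Each coordinate is then the indicator
  of a finite Boolean combination of comparisons of scores, which makes the map Borel
  measurable.\<close>

definition argmax_rule :: "real \<Rightarrow> real ^ 'a \<Rightarrow> real ^ 'a \<Rightarrow> real ^ 'a::finite" where
  "argmax_rule lam c g =
     (\<chi> i. if \<forall>j. score lam c g j < score lam c g i \<or>
                score lam c g j = score lam c g i \<and> to_nat i \<le> to_nat j then 1 else 0)"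

lemma argmax_rule_axis:
  "\<exists>i. (\<forall>j. score lam c g j \<le> score lam c g i) \<and> argmax_rule lam c g = axis i 1"
proof -
  let ?s = "score lam c g"
  have "Max (range ?s) \<in> range ?s" by (rule Max_in) auto
  then obtain k where "Max (range ?s) = ?s k" by (rule imageE)
  then have "\<forall>j. ?s j \<le> ?s k" by (metis Max_ge finite finite_imageI rangeI)
  \<comment> \<open>Among the maximizers, \<open>i\<close> is the one with the least code; the test
    in \<open>argmax_rule\<close> will hold for this index alone.\<close>
  then obtain i where i: "\<forall>j. ?s j \<le> ?s i" "\<And>k. \<forall>j. ?s j \<le> ?s k \<Longrightarrow> to_nat i \<le> to_nat k"
    using ex_has_least_nat[of "\<lambda>k. \<forall>j. ?s j \<le> ?s k" k to_nat] by blast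
  have "(\<forall>j. ?s j < ?s k \<or> ?s j = ?s k \<and> to_nat k \<le> to_nat j) \<longleftrightarrow> k = i" for k
  proof
    assume k: "\<forall>j. ?s j < ?s k \<or> ?s j = ?s k \<and> to_nat k \<le> to_nat j"
    then have "\<forall>j. ?s j \<le> ?s k" by (metis order.order_iff_strict)
    then have "to_nat i \<le> to_nat k" by (rule i(2))
    moreover have "to_nat k \<le> to_nat i" using k i(1) by (meson not_less)
    ultimately show "k = i" by (metis antisym from_nat_to_nat)
  next
    assume "k = i"
    with i show "\<forall>j. ?s j < ?s k \<or> ?s j = ?s k \<and> to_nat k \<le> to_nat j"
      by (smt (verit))
  qed
  then have "argmax_rule lam c g = axis i 1"
    unfolding argmax_rule_def by (simp add: axis_def)
  with i(1) show ?thesis by blast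
qed

lemma argmax_rule_eq_axis:
  assumes "\<And>j. j \<noteq> i \<Longrightarrow> score lam c g j < score lam c g i"
  shows "argmax_rule lam c g = axis i 1"
proof -
  obtain k where "\<forall>j. score lam c g j \<le> score lam c g k" "argmax_rule lam c g = axis k 1"
    using argmax_rule_axis by blast
  then show ?thesis using assms[of k] by (cases "k = i") (auto simp: not_less[symmetric])
qed

lemma argmax_rule_measurable [measurable]: "argmax_rule lam c \<in> borel_measurable borel"
  unfolding borel_measurable_vec_iff argmax_rule_def score_def vec_lambda_beta by measurable

section \<open>Averages against probability vectors\<close>

lemma axis_in_prob_vectors: "axis i 1 \<in> prob_vectors"
  by (auto simp: prob_vectors_def axis_def)

lemma prob_vectors_le_1:
  assumes "x \<in> prob_vectors"
  shows "x $ u \<le> 1"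
proof -
  have "x $ u \<le> (\<Sum>u\<in>UNIV. x $ u)"
    using assms by (intro member_le_sum) (auto simp: prob_vectors_def)
  then show ?thesis using assms by (simp add: prob_vectors_def)
qed

lemma prob_vectors_inner_le:
  assumes "x \<in> prob_vectors" "\<And>j. v $ j \<le> m"
  shows "v \<bullet> x \<le> m"
proof -
  have "v \<bullet> x \<le> (\<Sum>j\<in>UNIV. m * x $ j)"
    using assms by (auto simp: inner_vec_def prob_vectors_def intro!: sum_mono mult_right_mono)
  also have "\<dots> = m" using assms by (simp add: prob_vectors_def sum_distrib_left[symmetric])
  finally show ?thesis .
qed

text \<open>The nonnegative terms \<open>p $ j * (m - v $ j)\<close> add up to
  \<open>m - p \<bullet> v\<close>, which is at most zero. Each of them vanishes, and the positive
  weight cancels.\<close>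

lemma prob_vectors_inner_eq_max:
  assumes p: "p \<in> prob_vectors" "\<And>u. 0 < p $ u" and v: "\<And>j. v $ j \<le> m" "m \<le> p \<bullet> v"
  shows "v $ j = m"
proof -
  have "(\<Sum>j\<in>UNIV. p $ j * (m - v $ j)) = m - p \<bullet> v"
    using p by (simp add: right_diff_distrib sum_subtractf inner_vec_def prob_vectors_def
        flip: sum_distrib_right)
  moreover have "0 \<le> (\<Sum>j\<in>UNIV. p $ j * (m - v $ j))"
    using assms by (intro sum_nonneg) (simp add: less_imp_le)
  ultimately have "(\<Sum>j\<in>UNIV. p $ j * (m - v $ j)) = 0" using v by simp
  then have "p $ j * (m - v $ j) = 0"
    using assms by (subst (asm) sum_nonneg_eq_0_iff) (auto simp: less_imp_le)
  with p(2)[of j] show ?thesis by simp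
qed

section \<open>Argmax policies in terms of scores\<close>

lemma argmax_policy_policies: "argmax_policy M G p lam q \<Longrightarrow> q \<in> policies M G"
  by (simp add: argmax_policy_def)

lemma argmax_policyE:
  assumes "argmax_policy M G p lam q" "g \<in> rv_support M G"
  obtains i where "\<And>j. score lam (log_vec p) g j \<le> score lam (log_vec p) g i" "q g = axis i 1"
  using assms by (fastforce simp: argmax_policy_def is_arg_max_def score_def log_vec_def not_less)

text \<open>Provides a witness of \<open>argmax_policy\<close> for every real \<open>lam\<close>,
  both for the existence claim and as the representative whose gap is studied.\<close>

lemma argmax_policy_argmax_rule: "argmax_policy M G p lam (argmax_rule lam (log_vec p))"
proof -
  have ex: "\<exists>i. is_arg_max (\<lambda>j. g $ j + lam * ln (p $ j)) (\<lambda>_. True) i \<and>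
      argmax_rule lam (log_vec p) g = axis i 1" for g
    using argmax_rule_axis[of lam "log_vec p" g]
    by (fastforce simp: is_arg_max_def score_def log_vec_def not_less)
  then have "argmax_rule lam (log_vec p) g \<in> prob_vectors" for g
    by (metis axis_in_prob_vectors)
  with ex show ?thesis by (simp add: argmax_policy_def policies_def)
qed

section \<open>Almost sure absence of ties under i.i.d. noise\<close>

locale iid_noise = prob_space M for M :: "'w measure" +
  fixes G :: "'w \<Rightarrow> real ^ 'a::finite" and L :: "real measure"
  assumes indep: "indep_vars (\<lambda>_. borel) (\<lambda>u \<omega>. G \<omega> $ u) UNIV"
    and law: "\<And>u. distr M borel (\<lambda>\<omega>. G \<omega> $ u) = L"
    and continuous_law: "continuous_on UNIV (cdf L)"
    and integrable_law: "integrable L (\<lambda>x. x)"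
begin

lemma coord_measurable [measurable]: "(\<lambda>\<omega>. G \<omega> $ u) \<in> borel_measurable M"
  using indep by (simp add: indep_vars_def)

lemma G_measurable [measurable]: "G \<in> borel_measurable M"
  by (simp add: borel_measurable_vec_iff)

lemma integrable_coord: "integrable M (\<lambda>\<omega>. G \<omega> $ u)"
  using integrable_law unfolding law[of u, symmetric] by (simp add: integrable_distr_eq)

lemma AE_support: "AE \<omega> in M. G \<omega> \<in> rv_support M G"
  by (rule AE_in_rv_support) (auto intro: finite_measure_axioms)

lemma law_singleton: "measure L {x} = 0"
proof -
  interpret L: real_distribution L
    \<comment> \<open>All coordinates have law \<open>L\<close>; \<open>undefined\<close> serves as
      an arbitrary index.\<close>
    unfolding law[of undefined, symmetric] by (rule real_distribution_distr) simp
  show ?thesis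
    using continuous_law L.isCont_cdf[of x] by (simp add: continuous_on_eq_continuous_at)
qed

text \<open>A tie between \<open>i\<close> and \<open>j\<close> says that
  \<open>G \<omega> $ j\<close> is a constant shift of \<open>G \<omega> $ i\<close>, a null event
  for independent coordinates without atoms. There are finitely many pairs, and without ties any
  maximizer is strict.\<close>

lemma AE_strict_maximizer: "AE \<omega> in M. \<exists>i. \<forall>j. j \<noteq> i \<longrightarrow> score lam c (G \<omega>) j < score lam c (G \<omega>) i"
proof -
  have "AE \<omega> in M. \<forall>i. \<forall>j. j \<noteq> i \<longrightarrow> score lam c (G \<omega>) j \<noteq> score lam c (G \<omega>) i"
    unfolding AE_all_countable
  proof (intro allI)
    fix i j :: 'a
    show "AE \<omega> in M. j \<noteq> i \<longrightarrow> score lam c (G \<omega>) j \<noteq> score lam c (G \<omega>) i"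
    proof (cases "j = i")
      case False
      then have "indep_var borel (\<lambda>\<omega>. G \<omega> $ i) borel (\<lambda>\<omega>. G \<omega> $ j)"
        using indep_vars_imp_indep_var[OF indep, of i j] by simp
      then have "AE \<omega> in M. G \<omega> $ j \<noteq> G \<omega> $ i + (lam * c $ i - lam * c $ j)"
        by (rule AE_indep_neq_shift) (simp add: law law_singleton)
      then show ?thesis by (auto simp: score_def)
    qed simp
  qed
  then show ?thesis
  proof eventually_elim
    case (elim \<omega>)
    obtain i where "\<forall>j. score lam c (G \<omega>) j \<le> score lam c (G \<omega>) i"
      using argmax_rule_axis by blast
    with elim show ?case by (metis order.not_eq_order_implies_strict)
  qed
qed

text \<open>Such a policy can differ from \<open>argmax_rule\<close> only off the support or at a
  tie of scores, and both events are null.\<close>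

lemma AE_argmax_policy_eq:
  assumes "argmax_policy M G p lam q"
  shows "AE \<omega> in M. q (G \<omega>) = argmax_rule lam (log_vec p) (G \<omega>)"
  using AE_support AE_strict_maximizer[of lam "log_vec p"]
proof eventually_elim
  case (elim \<omega>)
  from elim(2) obtain i
    where i: "\<And>j. j \<noteq> i \<Longrightarrow> score lam (log_vec p) (G \<omega>) j < score lam (log_vec p) (G \<omega>) i"
    by blast
  obtain k where "\<And>j. score lam (log_vec p) (G \<omega>) j \<le> score lam (log_vec p) (G \<omega>) k"
    "q (G \<omega>) = axis k 1"
    using argmax_policyE[OF assms elim(1)] by blast
  with i argmax_rule_eq_axis[OF i] show ?case by (metis not_less)
qed

section \<open>Integrability of policies and rewards\<close>

lemma policy_measurable:
  assumes "r \<in> policies M G"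
  shows "(\<lambda>\<omega>. r (G \<omega>) $ u) \<in> borel_measurable M"
proof -
  have "(\<lambda>\<omega>. r (G \<omega>)) \<in> borel_measurable M"
    using assms by (intro measurable_compose[OF G_measurable]) (simp add: policies_def)
  then show ?thesis by (simp add: borel_measurable_vec_iff)
qed

lemma AE_policy: "r \<in> policies M G \<Longrightarrow> AE \<omega> in M. r (G \<omega>) \<in> prob_vectors"
  using AE_support by (auto simp: policies_def)

lemma AE_policy_bound:
  assumes "r \<in> policies M G"
  shows "AE \<omega> in M. \<bar>r (G \<omega>) $ u\<bar> \<le> 1"
  using AE_policy[OF assms] 
proof eventually_elim
  case (elim \<omega>)
  then show ?case using prob_vectors_le_1[OF elim, of u] by (simp add: prob_vectors_def)
qed

lemma integrable_policy: "r \<in> policies M G \<Longrightarrow> integrable M (\<lambda>\<omega>. r (G \<omega>) $ u)"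
  by (rule integrable_const_bound[where B = 1]) (auto intro: AE_policy_bound policy_measurable)

text \<open>Policy values lie in [0, 1] almost surely, so each summand is dominated by a noise
  coordinate, integrable because \<open>L\<close> has a first moment.\<close>

lemma integrable_reward:
  assumes "r \<in> policies M G"
  shows "integrable M (\<lambda>\<omega>. G \<omega> \<bullet> r (G \<omega>))"
  unfolding inner_vec_def
proof (rule Bochner_Integration.integrable_sum)
  fix u
  show "integrable M (\<lambda>\<omega>. G \<omega> $ u \<bullet> r (G \<omega>) $ u)"
  proof (rule Bochner_Integration.integrable_bound[OF integrable_coord[of u]])
    show "(\<lambda>\<omega>. G \<omega> $ u \<bullet> r (G \<omega>) $ u) \<in> borel_measurable M"
      using policy_measurable[OF assms] by simp
    show "AE \<omega> in M. norm (G \<omega> $ u \<bullet> r (G \<omega>) $ u) \<le> norm (G \<omega> $ u)"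
      using AE_policy_bound[OF assms, of u]
      by eventually_elim (simp add: abs_mult mult_left_le)
  qed
qed

lemma integrable_inner_policy: "r \<in> policies M G \<Longrightarrow> integrable M (\<lambda>\<omega>. c \<bullet> r (G \<omega>))"
  unfolding inner_vec_def by (simp add: integrable_policy)

section \<open>The gap as an integral and the Lagrangian bound\<close>

lemma log_gap_eq:
  assumes "r \<in> policies M G"
  shows "log_gap M G p r = p \<bullet> log_vec p - (\<integral>\<omega>. log_vec p \<bullet> r (G \<omega>) \<partial>M)"
proof -
  have "(\<integral>\<omega>. log_vec p \<bullet> r (G \<omega>) \<partial>M) = mean_policy M G r \<bullet> log_vec p"
    unfolding inner_vec_def mean_policy_def
    by (simp add: integrable_policy[OF assms] mult.commute)
  then show ?thesis by (simp add: log_gap_def inner_diff_left)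
qed

text \<open>Tie-breaking is invisible to integrals, so the gap is a function of \<open>lam\<close>
  alone and can be computed with \<open>argmax_rule\<close>.\<close>

lemma log_gap_argmax_policy:
  assumes "argmax_policy M G p lam q"
  shows "log_gap M G p q = log_gap M G p (argmax_rule lam (log_vec p))"
proof -
  note pol = assms[THEN argmax_policy_policies]
    argmax_policy_argmax_rule[of M G p lam, THEN argmax_policy_policies]
  have "(\<integral>\<omega>. log_vec p \<bullet> q (G \<omega>) \<partial>M) = (\<integral>\<omega>. log_vec p \<bullet> argmax_rule lam (log_vec p) (G \<omega>) \<partial>M)"
    using AE_argmax_policy_eq[OF assms] integrable_inner_policy[OF pol(1)] integrable_inner_policy[OF pol(2)]
    by (intro integral_cong_AE) auto
  then show ?thesis by (simp add: log_gap_eq pol)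
qed

text \<open>Both sides are averages of the scores. The right one puts all its weight on a maximal
  score.\<close>

lemma AE_lagrangian_le:
  assumes "argmax_policy M G p lam q" "r \<in> policies M G"
  shows "AE \<omega> in M. G \<omega> \<bullet> r (G \<omega>) + lam * (log_vec p \<bullet> r (G \<omega>))
    \<le> G \<omega> \<bullet> q (G \<omega>) + lam * (log_vec p \<bullet> q (G \<omega>))"
  using AE_support AE_policy[OF assms(2)]
proof eventually_elim
  case (elim \<omega>)
  obtain i where i: "\<And>j. score lam (log_vec p) (G \<omega>) j \<le> score lam (log_vec p) (G \<omega>) i"
    "q (G \<omega>) = axis i 1"
    using argmax_policyE[OF assms(1) elim(1)] by blast
  have "(G \<omega> + lam *\<^sub>R log_vec p) \<bullet> r (G \<omega>) \<le> score lam (log_vec p) (G \<omega>) i"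
    using i(1) by (intro prob_vectors_inner_le elim(2)) (simp add: score_def)
  then show ?case by (simp add: i(2) inner_axis score_def inner_add_left)
qed

text \<open>Integrate the pointwise bound; the constant \<open>lam * (p \<bullet> log_vec p)\<close>
  enters both sides alike. The sign of \<open>lam\<close> matters only later, when the constraint is
  used.\<close>

lemma lagrangian_le:
  assumes q: "argmax_policy M G p lam q" and r: "r \<in> policies M G"
  shows "objective M G r - lam * log_gap M G p r \<le> objective M G q - lam * log_gap M G p q"
proof -
  note qp = argmax_policy_policies[OF q]
  note int = integrable_reward[OF qp] integrable_reward[OF r]
    integrable_inner_policy[OF qp] integrable_inner_policy[OF r]
  have "(\<integral>\<omega>. G \<omega> \<bullet> r (G \<omega>) + lam * (log_vec p \<bullet> r (G \<omega>)) \<partial>M)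
    \<le> (\<integral>\<omega>. G \<omega> \<bullet> q (G \<omega>) + lam * (log_vec p \<bullet> q (G \<omega>)) \<partial>M)"
    by (rule integral_mono_AE[OF _ _ AE_lagrangian_le[OF q r]]) (simp_all add: int)
  then show ?thesis
    by (simp add: int objective_def log_gap_eq r qp algebra_simps)
qed

section \<open>The gap as a function of the multiplier\<close>

text \<open>Dominated convergence: the integrand is always a coordinate of \<open>c\<close>, hence
  bounded by \<open>norm c\<close>. This serves both continuity in \<open>lam\<close> and the limit
  at infinity.\<close>

lemma integral_argmax_rule_tendsto:
  assumes "AE \<omega> in M. (\<lambda>n. c \<bullet> argmax_rule (x n) c (G \<omega>)) \<longlonglongrightarrow> f \<omega>" and "f \<in> borel_measurable M"
  shows "(\<lambda>n. \<integral>\<omega>. c \<bullet> argmax_rule (x n) c (G \<omega>) \<partial>M) \<longlonglongrightarrow> (\<integral>\<omega>. f \<omega> \<partial>M)"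
proof (rule integral_dominated_convergence[OF assms(2) _ _ assms(1)])
  show "integrable M (\<lambda>_. norm c)" by simp
  show "AE \<omega> in M. norm (c \<bullet> argmax_rule (x n) c (G \<omega>)) \<le> norm c" for n
  proof (intro AE_I2)
    fix \<omega>
    obtain i where "argmax_rule (x n) c (G \<omega>) = axis i 1" using argmax_rule_axis by blast
    then show "norm (c \<bullet> argmax_rule (x n) c (G \<omega>)) \<le> norm c"
      by (simp add: inner_axis component_le_norm_cart)
  qed
qed measurable

text \<open>Almost surely the maximizer at \<open>lam\<close> is strict. Finitely many strict
  inequalities survive small changes of \<open>lam\<close>, so along a convergent sequence the
  integrand is eventually constant.\<close>

lemma continuous_argmax_rule_integral:
  "continuous_on UNIV (\<lambda>lam. \<integral>\<omega>. c \<bullet> argmax_rule lam c (G \<omega>) \<partial>M)"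
  unfolding continuous_on_eq_continuous_at[OF open_UNIV]
proof (intro ballI continuous_at_sequentiallyI)
  fix lam :: real and x :: "nat \<Rightarrow> real" assume x: "x \<longlonglongrightarrow> lam"
  show "(\<lambda>n. \<integral>\<omega>. c \<bullet> argmax_rule (x n) c (G \<omega>) \<partial>M)
    \<longlonglongrightarrow> (\<integral>\<omega>. c \<bullet> argmax_rule lam c (G \<omega>) \<partial>M)"
  proof (rule integral_argmax_rule_tendsto)
    show "AE \<omega> in M. (\<lambda>n. c \<bullet> argmax_rule (x n) c (G \<omega>)) \<longlonglongrightarrow> c \<bullet> argmax_rule lam c (G \<omega>)"
      using AE_strict_maximizer[of lam c]
    proof eventually_elim
      case (elim \<omega>)
      then obtain i where i: "\<And>j. j \<noteq> i \<Longrightarrow> score lam c (G \<omega>) j < score lam c (G \<omega>) i" by blast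
      have lim: "(\<lambda>n. score (x n) c (G \<omega>) j) \<longlonglongrightarrow> score lam c (G \<omega>) j" for j
        unfolding score_def by (intro tendsto_intros x)
      have "\<forall>\<^sub>F n in sequentially. \<forall>j. j \<noteq> i \<longrightarrow> score (x n) c (G \<omega>) j < score (x n) c (G \<omega>) i"
      proof (intro eventually_all_finite)
        fix j
        show "\<forall>\<^sub>F n in sequentially. j \<noteq> i \<longrightarrow> score (x n) c (G \<omega>) j < score (x n) c (G \<omega>) i"
        proof (cases "j = i")
          case False
          then show ?thesis
            using order_tendstoD(1)[OF tendsto_diff[OF lim[of i] lim[of j]], of 0] i[OF False] by simp
        qed simp
      qed
      then have "\<forall>\<^sub>F n in sequentially. c \<bullet> argmax_rule (x n) c (G \<omega>) = c \<bullet> argmax_rule lam c (G \<omega>)"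
        by eventually_elim (simp add: argmax_rule_eq_axis[of i, OF i] argmax_rule_eq_axis[of i])
      then show ?case by (rule tendsto_eventually)
    qed
  qed measurable
qed

text \<open>For each outcome the noise is fixed while the weight of \<open>c\<close> in the scores
  grows, so the chosen index comes to maximize \<open>c\<close>.\<close>

lemma argmax_rule_integral_tendsto_Max:
  "(\<lambda>n. \<integral>\<omega>. c \<bullet> argmax_rule (real n) c (G \<omega>) \<partial>M) \<longlonglongrightarrow> Max (range (($) c))"
proof -
  define m where "m = Max (range (($) c))"
  have m_ge: "c $ j \<le> m" for j by (simp add: m_def)
  have "m \<in> range (($) c)" unfolding m_def by (rule Max_in) auto
  then obtain k where k: "c $ k = m" by auto
  have "(\<lambda>n. \<integral>\<omega>. c \<bullet> argmax_rule (real n) c (G \<omega>) \<partial>M) \<longlonglongrightarrow> (\<integral>\<omega>. m \<partial>M)"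
  proof (rule integral_argmax_rule_tendsto)
    show "AE \<omega> in M. (\<lambda>n. c \<bullet> argmax_rule (real n) c (G \<omega>)) \<longlonglongrightarrow> m"
    proof (intro AE_I2)
      fix \<omega>
      let ?B = "2 * norm (G \<omega>)"
      \<comment> \<open>Here \<open>k\<close> maximizes \<open>c\<close>, and the chosen index
        \<open>i\<close> scores at least as high, so \<open>real n * (m - c $ i)\<close> is at most
        \<open>G \<omega> $ i - G \<omega> $ k\<close>, hence at most \<open>?B\<close>.\<close>
      have bd: "m - ?B / real n \<le> c \<bullet> argmax_rule (real n) c (G \<omega>)" if "0 < n" for n
      proof -
        obtain i where i: "score (real n) c (G \<omega>) k \<le> score (real n) c (G \<omega>) i"
          "argmax_rule (real n) c (G \<omega>) = axis i 1"
          using argmax_rule_axis by blast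
        have "\<bar>G \<omega> $ i\<bar> \<le> norm (G \<omega>)" "\<bar>G \<omega> $ k\<bar> \<le> norm (G \<omega>)"
          by (rule component_le_norm_cart)+
        then have "real n * m \<le> real n * c $ i + ?B"
          using i(1) by (simp add: score_def k)
        then have "m - ?B / real n \<le> c $ i" using that by (simp add: field_simps)
        then show ?thesis by (simp add: i inner_axis)
      qed
      have up: "c \<bullet> argmax_rule (real n) c (G \<omega>) \<le> m" for n
        using argmax_rule_axis[of "real n" c "G \<omega>"] by (auto simp: inner_axis m_ge)
      show "(\<lambda>n. c \<bullet> argmax_rule (real n) c (G \<omega>)) \<longlonglongrightarrow> m"
      proof (rule tendsto_sandwich[where f = "\<lambda>n. m - ?B / real n" and h = "\<lambda>_. m"])
        show "\<forall>\<^sub>F n in sequentially. m - ?B / real n \<le> c \<bullet> argmax_rule (real n) c (G \<omega>)"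
          using eventually_gt_at_top[of 0] by eventually_elim (rule bd)
        show "(\<lambda>n. m - ?B / real n) \<longlonglongrightarrow> m"
          using tendsto_diff[OF tendsto_const lim_const_over_n, of m ?B] by simp
      qed (simp_all add: up)
    qed
  qed simp
  then show ?thesis by (simp add: m_def prob_space)
qed

text \<open>Used in contrapositive form: when no nonnegative multiplier attains equality, the rule
  with multiplier zero satisfies the constraint.\<close>

lemma exists_multiplier:
  assumes p: "p \<in> prob_vectors" "\<And>u. 0 < p $ u" and "0 \<le> \<epsilon>"
    and gap: "\<epsilon> < log_gap M G p (argmax_rule 0 (log_vec p))"
  shows "\<exists>mu\<ge>0. log_gap M G p (argmax_rule mu (log_vec p)) = \<epsilon>"
proof -
  define c where "c = log_vec p"
  define m where "m = Max (range (($) c))"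
  define F where "F lam = p \<bullet> c - (\<integral>\<omega>. c \<bullet> argmax_rule lam c (G \<omega>) \<partial>M)" for lam
  have F: "log_gap M G p (argmax_rule lam c) = F lam" for lam
    unfolding F_def c_def
    by (rule log_gap_eq) (rule argmax_policy_policies[OF argmax_policy_argmax_rule])
  have m_ge: "c $ j \<le> m" for j by (simp add: m_def)
  \<comment> \<open>Strictness puts the limit of the gap below \<open>\<epsilon>\<close> even when
    \<open>\<epsilon>\<close> is zero, so that a finite \<open>n\<close> has gap below
    \<open>\<epsilon>\<close>. Equality would make \<open>c\<close> constant and the gap at zero
    nonpositive, against \<open>gap\<close>.\<close>
  have "p \<bullet> c < m"
  proof (rule ccontr)
    assume "\<not> p \<bullet> c < m"
    then have const: "c $ j = m" for j
      using prob_vectors_inner_eq_max[OF p, of c m j] m_ge by simp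
    have "c \<bullet> argmax_rule 0 c (G \<omega>) = m" for \<omega>
      using argmax_rule_axis[of 0 c "G \<omega>"] const by (auto simp: inner_axis)
    moreover have "p \<bullet> c \<le> m"
      using prob_vectors_inner_le[OF p(1) m_ge] by (simp add: inner_commute)
    ultimately have "F 0 \<le> 0" by (simp add: F_def prob_space)
    with gap \<open>0 \<le> \<epsilon>\<close> F[of 0] show False by (simp add: c_def)
  qed
  then have "p \<bullet> c - m < \<epsilon>" using \<open>0 \<le> \<epsilon>\<close> by simp
  moreover have "(\<lambda>n. F (real n)) \<longlonglongrightarrow> p \<bullet> c - m"
    unfolding F_def m_def by (intro tendsto_diff tendsto_const argmax_rule_integral_tendsto_Max)
  ultimately have "\<forall>\<^sub>F n in sequentially. F (real n) < \<epsilon>" by (rule order_tendstoD(2)[rotated])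
  then obtain n where n: "F (real n) < \<epsilon>" by (auto simp: eventually_sequentially)
  have "continuous_on {0..real n} F"
    unfolding F_def
    by (intro continuous_intros continuous_on_subset[OF continuous_argmax_rule_integral]) simp
  then obtain mu where "0 \<le> mu" "F mu = \<epsilon>"
    using IVT2'[of F "real n" \<epsilon> 0] n gap F[of 0] by (auto simp: c_def)
  then show ?thesis using F by (auto simp: c_def)
qed

end

theorem theoremD9:
  fixes M :: "'w measure" and G :: "'w \<Rightarrow> real ^ 'a::finite" and L :: "real measure"
    and p :: "real ^ 'a" and \<epsilon> :: real
  assumes "prob_space M"
    and "p \<in> prob_vectors" and "\<forall>u. 0 < p $ u"
    and "prob_space.indep_vars M (\<lambda>_. borel) (\<lambda>u \<omega>. G \<omega> $ u) UNIV"
    and "\<forall>u. distr M borel (\<lambda>\<omega>. G \<omega> $ u) = L"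
    and "continuous_on UNIV (cdf L)"
    and "integrable L (\<lambda>x. x)"
    and "0 \<le> \<epsilon>"
  shows "(\<exists>lam q. argmax_policy M G p lam q \<and> multiplier_choice M G p \<epsilon> lam q) \<and>
    (\<forall>lam q. argmax_policy M G p lam q \<longrightarrow> multiplier_choice M G p \<epsilon> lam q \<longrightarrow>
       optimal_policy M G p \<epsilon> q)"
proof (intro conjI allI impI)
  interpret iid_noise M G L
    using assms by (simp add: iid_noise_def iid_noise_axioms_def)
  show "\<exists>lam q. argmax_policy M G p lam q \<and> multiplier_choice M G p \<epsilon> lam q"
  proof (cases "\<exists>mu\<ge>0. \<exists>r. argmax_policy M G p mu r \<and> log_gap M G p r = \<epsilon>")
    case True
    then show ?thesis unfolding multiplier_choice_def by auto
  next
    case False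
    then have "multiplier_choice M G p \<epsilon> 0 q" for q unfolding multiplier_choice_def by auto
    then show ?thesis using argmax_policy_argmax_rule by blast
  qed
  fix lam q
  assume q: "argmax_policy M G p lam q" and lam: "multiplier_choice M G p \<epsilon> lam q"
  \<comment> \<open>The Karush-Kuhn-Tucker conditions: a nonnegative multiplier, feasibility and
    complementary slackness.\<close>
  have kkt: "0 \<le> lam" "log_gap M G p q \<le> \<epsilon>" "lam * log_gap M G p q = lam * \<epsilon>"
  proof -
    show "0 \<le> lam" using lam by (auto simp: multiplier_choice_def split: if_splits)
    have "log_gap M G p q = \<epsilon> \<or> lam = 0 \<and> log_gap M G p q \<le> \<epsilon>"
    proof (cases "\<exists>mu\<ge>0. \<exists>r. argmax_policy M G p mu r \<and> log_gap M G p r = \<epsilon>")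
      case True
      with lam show ?thesis by (simp add: multiplier_choice_def)
    next
      case False
      then have "lam = 0" using lam unfolding multiplier_choice_def by presburger
      moreover have "\<not> \<epsilon> < log_gap M G p (argmax_rule 0 (log_vec p))"
        using exists_multiplier[of p \<epsilon>] False assms argmax_policy_argmax_rule by blast
      ultimately show ?thesis using log_gap_argmax_policy[OF q] by simp
    qed
    then show "log_gap M G p q \<le> \<epsilon>" "lam * log_gap M G p q = lam * \<epsilon>" by auto
  qed
  \<comment> \<open>Weak duality: \<open>lam * log_gap M G p r\<close> is at most
    \<open>lam * \<epsilon>\<close>, which equals \<open>lam * log_gap M G p q\<close>, so the
    penalty terms in \<open>lagrangian_le\<close> can only favour \<open>q\<close>.\<close>
  have "objective M G r \<le> objective M G q" if r: "r \<in> policies M G" "log_gap M G p r \<le> \<epsilon>" for r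
    using lagrangian_le[OF q r(1)] kkt mult_left_mono[OF r(2) kkt(1)] by linarith
  then show "optimal_policy M G p \<epsilon> q"
    using kkt(2) argmax_policy_policies[OF q]
    by (auto simp: optimal_policy_def is_arg_max_def not_less)
qed

end
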